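(* Let $K$ be a field, $R$ a unital $K$-algebra, and $E$ a finite graph satisfying condition $(L)$. Then the Leavitt path algebra $L_R(E)$ can be embedded into the Leavitt algebra $L_R(1,2)$; that is, there is an injective homomorphism of $R$-algebras $L_R(E)\to L_R(1,2)$.
   Context: A (directed) graph $E=(E^0,E^1,s,r)$ consists of disjoint sets $E^0$ (vertices) and $E^1$ (edges) and maps $s,r:E^1\to E^0$ (source and range). It is finite if $E^0$ and $E^1$ are finite. A vertex $v$ is regular if $0<|s^{-1}(v)|<\infty$. A path is a sequence of edges $p=e_1\cdots e_n$ with $r(e_i)=s(e_{i+1})$ for $1\le i\le n-1$; it is a cycle if $s(e_1)=r(e_n)$ and it does not revisit any other vertex (i.e. $s(e_1),\dots,s(e_n)$ are distinct). An edge $f$ is an exit for $p$ if $s(f)=s(e_i)$ and $f\ne e_i$ for some $i$. $E$ satisfies condition $(L)$ if every cycle in $E$ has an exit. For a unital ring $R$, the Leavitt path algebra $L_R(E)$ is the $R$-algebra generated by $E^0\cup E^1\cup\{e^*: e\in E^1\}$ (coefficients from $R$ commute with the generators) with relations, for all $v,w\in E^0$, $e,f\in E^1$: (1) $vw=\delta_{v,w}w$; (2) $s(e)e=e=er(e)$ and $r(e)e^*=e^*=e^*s(e)$; (3) $e^*f=\delta_{e,f}r(e)$; (4) $v=\sum_{e\in s^{-1}(v)}ee^*$ for every regular vertex $v$. $L_R(1,2)$ is the unital $R$-algebra generated by $x_1,x_2,x_1^*,x_2^*$ (commuting with coefficients from $R$) with relations $x_1x_1^*+x_2x_2^*=1$,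 $x_1^*x_1=x_2^*x_2=1$, $x_1^*x_2=x_2^*x_1=0$. The ring $R$ need not be commutative; for a $K$-algebra $R$ one has $L_R(E)=L_K(E)\otimes_K R$ and $L_R(1,2)=L_K(1,2)\otimes_K R$. A homomorphism of $R$-algebras here is a ring homomorphism (not required to be unital) that is linear for the left and right $R$-actions. *)

theory Defs
  imports Main "HOL-Library.Poly_Mapping" "Graph_Theory.Digraph" "Graph_Theory.Arc_Walk"
begin

text \<open>
  Coefficient rings are types of sort \<open>{ring, monoid_mult}\<close>: associative rings with a
  two-sided unit, not necessarily commutative.  The class \<open>ring_1\<close> is avoided because it
  excludes the zero ring.
\<close>

locale unital_algebra = vector_space scale
  for scale :: "'k::field \<Rightarrow> 'r::{ring, monoid_mult} \<Rightarrow> 'r" +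
  assumes scale_mult_left: "scale a (x * y) = scale a x * y"
    and scale_mult_right: "scale a (x * y) = x * scale a y"

text \<open>
  Words over an alphabet, with concatenation written additively, because the convolution
  product of \<^typ>\<open>'a \<Rightarrow>\<^sub>0 'b\<close> requires \<^class>\<open>monoid_add\<close> on the exponents.
\<close>

datatype 'g word = Word (letters: "'g list")

instantiation word :: (type) monoid_add
begin

definition zero_word_def: "0 = Word []"

definition plus_word_def: "u + v = Word (letters u @ letters v)"

instance
  by standard (simp_all add: zero_word_def plus_word_def)

end

text \<open>
  \<^typ>\<open>'g word \<Rightarrow>\<^sub>0 'r\<close> is the free unital algebra over \<^typ>\<open>'r\<close>: the coefficients commute with
  the letters, and the product multiplies the coefficients in the given order.
\<close>

type_synonym ('g, 'r) free_alg = "'g word \<Rightarrow>\<^sub>0 'r"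

definition coef :: "'r \<Rightarrow> ('g, 'r::zero) free_alg" where
  "coef c = Poly_Mapping.single 0 c"

definition gen :: "'g \<Rightarrow> ('g, 'r::{ring, monoid_mult}) free_alg" where
  "gen g = Poly_Mapping.single (Word [g]) 1"

definition span_words :: "'g word set \<Rightarrow> ('g, 'r::zero) free_alg set" where
  "span_words W = {f. Poly_Mapping.keys f \<subseteq> W}"

definition unital_words :: "'g set \<Rightarrow> 'g word set" where
  "unital_words X = {w. set (letters w) \<subseteq> X}"

definition nonunital_words :: "'g set \<Rightarrow> 'g word set" where
  "nonunital_words X = {w. letters w \<noteq> [] \<and> set (letters w) \<subseteq> X}"

text \<open>
  The two-sided ideal, stable under both actions of the coefficient ring, that the
  differences \<open>a - b\<close> with \<open>(a, b) \<in> S\<close> generate in the algebra \<open>span_words W\<close>.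
  The closure under \<open>coef c\<close> is not subsumed by the closure under \<open>span_words W\<close>
  when \<open>W\<close> does not contain the empty word.
\<close>

inductive_set rel_ideal ::
    "'g word set \<Rightarrow> (('g, 'r::ring) free_alg \<times> ('g, 'r) free_alg) set \<Rightarrow> ('g, 'r) free_alg set"
  for W :: "'g word set" and S :: "(('g, 'r::ring) free_alg \<times> ('g, 'r) free_alg) set"
where
  zero: "0 \<in> rel_ideal W S"
| base: "(a, b) \<in> S \<Longrightarrow> a - b \<in> rel_ideal W S"
| diff: "f \<in> rel_ideal W S \<Longrightarrow> h \<in> rel_ideal W S \<Longrightarrow> f - h \<in> rel_ideal W S"
| mult_left: "f \<in> rel_ideal W S \<Longrightarrow> h \<in> span_words W \<Longrightarrow> h * f \<in> rel_ideal W S"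
| mult_right: "f \<in> rel_ideal W S \<Longrightarrow> h \<in> span_words W \<Longrightarrow> f * h \<in> rel_ideal W S"
| coef_left: "f \<in> rel_ideal W S \<Longrightarrow> coef c * f \<in> rel_ideal W S"
| coef_right: "f \<in> rel_ideal W S \<Longrightarrow> f * coef c \<in> rel_ideal W S"

definition rel_cong ::
    "'g word set \<Rightarrow> (('g, 'r::ring) free_alg \<times> ('g, 'r) free_alg) set \<Rightarrow>
     (('g, 'r) free_alg \<times> ('g, 'r) free_alg) set" where
  "rel_cong W S = {(f, h). f \<in> span_words W \<and> h \<in> span_words W \<and> f - h \<in> rel_ideal W S}"

text \<open>
  There is no field for a unit, since a Leavitt path algebra need not have one and
  homomorphisms are not required to be unital.
\<close>

record ('r, 'a) ralgebra =
  acarrier :: "'a set"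
  aadd :: "'a \<Rightarrow> 'a \<Rightarrow> 'a"
  amult :: "'a \<Rightarrow> 'a \<Rightarrow> 'a"
  lscale :: "'r \<Rightarrow> 'a \<Rightarrow> 'a"
  rscale :: "'a \<Rightarrow> 'r \<Rightarrow> 'a"

definition presented_algebra ::
    "'g word set \<Rightarrow> (('g, 'r::ring) free_alg \<times> ('g, 'r) free_alg) set \<Rightarrow>
     ('r, ('g, 'r) free_alg set) ralgebra" where
  "presented_algebra W S =
    \<lparr>acarrier = span_words W // rel_cong W S,
     aadd = (\<lambda>A B. \<Union>a\<in>A. \<Union>b\<in>B. rel_cong W S `` {a + b}),
     amult = (\<lambda>A B. \<Union>a\<in>A. \<Union>b\<in>B. rel_cong W S `` {a * b}),
     lscale = (\<lambda>c A. \<Union>a\<in>A. rel_cong W S `` {coef c * a}),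
     rscale = (\<lambda>A c. \<Union>a\<in>A. rel_cong W S `` {a * coef c})\<rparr>"

definition ralgebra_hom ::
    "('r, 'a) ralgebra \<Rightarrow> ('r, 'b) ralgebra \<Rightarrow> ('a \<Rightarrow> 'b) set" where
  "ralgebra_hom A B = {\<phi>.
     (\<forall>x\<in>acarrier A. \<phi> x \<in> acarrier B) \<and>
     (\<forall>x\<in>acarrier A. \<forall>y\<in>acarrier A. \<phi> (aadd A x y) = aadd B (\<phi> x) (\<phi> y)) \<and>
     (\<forall>x\<in>acarrier A. \<forall>y\<in>acarrier A. \<phi> (amult A x y) = amult B (\<phi> x) (\<phi> y)) \<and>
     (\<forall>c. \<forall>x\<in>acarrier A. \<phi> (lscale A c x) = lscale B c (\<phi> x)) \<and>
     (\<forall>c. \<forall>x\<in>acarrier A. \<phi> (rscale A x c) = rscale B (\<phi> x) c)}"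

text \<open>
  Source and range of an edge are \<^const>\<open>tail\<close> and \<^const>\<open>head\<close>.  A cycle is
  \<^const>\<open>pre_digraph.cycle\<close>, which allows loops; it demands that the ranges of the edges of
  a nonempty closed walk are distinct, and these are the sources up to rotation.
\<close>

definition regular_vertex :: "('v, 'e) pre_digraph \<Rightarrow> 'v \<Rightarrow> bool" where
  "regular_vertex G v \<longleftrightarrow> v \<in> verts G \<and> finite (out_arcs G v) \<and> out_arcs G v \<noteq> {}"

definition is_exit :: "('v, 'e) pre_digraph \<Rightarrow> 'e \<Rightarrow> 'e list \<Rightarrow> bool" where
  "is_exit G f p \<longleftrightarrow> f \<in> arcs G \<and> (\<exists>e\<in>set p. tail G f = tail G e \<and> f \<noteq> e)"

definition condition_L :: "('v, 'e) pre_digraph \<Rightarrow> bool" where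
  "condition_L G \<longleftrightarrow> (\<forall>p. pre_digraph.cycle G p \<longrightarrow> (\<exists>f. is_exit G f p))"

datatype ('v, 'e) lpa_gen = Vert 'v | Edge 'e | Ghost 'e

definition lpa_gens :: "('v, 'e) pre_digraph \<Rightarrow> ('v, 'e) lpa_gen set" where
  "lpa_gens G = Vert ` verts G \<union> Edge ` arcs G \<union> Ghost ` arcs G"

definition lpa_rels ::
    "('v, 'e) pre_digraph \<Rightarrow>
     ((('v, 'e) lpa_gen, 'r::{ring, monoid_mult}) free_alg \<times> (('v, 'e) lpa_gen, 'r) free_alg) set" where
  "lpa_rels G =
     {(gen (Vert v) * gen (Vert w), if v = w then gen (Vert w) else 0) | v w.
        v \<in> verts G \<and> w \<in> verts G} \<union>
     {(gen (Vert (tail G e)) * gen (Edge e), gen (Edge e)) | e. e \<in> arcs G} \<union>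
     {(gen (Edge e) * gen (Vert (head G e)), gen (Edge e)) | e. e \<in> arcs G} \<union>
     {(gen (Vert (head G e)) * gen (Ghost e), gen (Ghost e)) | e. e \<in> arcs G} \<union>
     {(gen (Ghost e) * gen (Vert (tail G e)), gen (Ghost e)) | e. e \<in> arcs G} \<union>
     {(gen (Ghost e) * gen (Edge f), if e = f then gen (Vert (head G e)) else 0) | e f.
        e \<in> arcs G \<and> f \<in> arcs G} \<union>
     {(gen (Vert v), \<Sum>e\<in>out_arcs G v. gen (Edge e) * gen (Ghost e)) | v. regular_vertex G v}"

text \<open>
  \<open>L\<^sub>R(E)\<close> is presented without the empty word: no unit is adjoined to the algebra
  generated by the vertices, edges and ghost edges.
\<close>

definition leavitt_path_algebra ::
    "'r itself \<Rightarrow> ('v, 'e) pre_digraph \<Rightarrow>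
     ('r::{ring, monoid_mult}, (('v, 'e) lpa_gen, 'r) free_alg set) ralgebra" where
  "leavitt_path_algebra _ G = presented_algebra (nonunital_words (lpa_gens G)) (lpa_rels G)"

datatype leavitt_gen = X1 | X2 | X1s | X2s

definition leavitt_rels ::
    "((leavitt_gen, 'r::{ring, monoid_mult}) free_alg \<times> (leavitt_gen, 'r) free_alg) set" where
  "leavitt_rels =
     {(gen X1 * gen X1s + gen X2 * gen X2s, coef 1),
      (gen X1s * gen X1, coef 1),
      (gen X2s * gen X2, coef 1),
      (gen X1s * gen X2, 0),
      (gen X2s * gen X1, 0)}"

definition leavitt_algebra_1_2 ::
    "'r itself \<Rightarrow> ('r::{ring, monoid_mult}, (leavitt_gen, 'r) free_alg set) ralgebra" where
  "leavitt_algebra_1_2 _ = presented_algebra (unital_words UNIV) leavitt_rels"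

text \<open>The operations of a presented algebra are computed on representatives.\<close>

lemma span_words_zero: "0 \<in> span_words W"
  by (simp add: span_words_def)

lemma span_words_add:
  fixes f h :: "('g, 'r::ring) free_alg"
  shows "f \<in> span_words W \<Longrightarrow> h \<in> span_words W \<Longrightarrow> f + h \<in> span_words W"
  unfolding span_words_def using Poly_Mapping.keys_add[of f h] by blast

lemma span_words_mult:
  fixes f h :: "('g, 'r::ring) free_alg"
  assumes "\<And>u v. u \<in> W \<Longrightarrow> v \<in> W \<Longrightarrow> u + v \<in> W"
  shows "f \<in> span_words W \<Longrightarrow> h \<in> span_words W \<Longrightarrow> f * h \<in> span_words W"
  unfolding span_words_def using Poly_Mapping.keys_mult[of f h] assms by blast

lemma span_words_coef:
  fixes f :: "('g, 'r::ring) free_alg"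
  assumes "f \<in> span_words W"
  shows "coef c * f \<in> span_words W" and "f * coef c \<in> span_words W"
proof -
  have "Poly_Mapping.keys (coef c :: ('g, 'r) free_alg) \<subseteq> {0}"
    by (simp add: coef_def)
  then show "coef c * f \<in> span_words W" "f * coef c \<in> span_words W"
    using assms Poly_Mapping.keys_mult[of "coef c" f] Poly_Mapping.keys_mult[of f "coef c"]
    unfolding span_words_def by force+
qed

lemma words_closed:
  "u \<in> unital_words X \<Longrightarrow> v \<in> unital_words X \<Longrightarrow> u + v \<in> unital_words X"
  "u \<in> nonunital_words X \<Longrightarrow> v \<in> nonunital_words X \<Longrightarrow> u + v \<in> nonunital_words X"
  by (auto simp: unital_words_def nonunital_words_def plus_word_def)

lemma rel_ideal_add:
  assumes "f \<in> rel_ideal W S" and "h \<in> rel_ideal W S"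
  shows "f + h \<in> rel_ideal W S"
  using rel_ideal.diff[OF assms(1) rel_ideal.diff[OF rel_ideal.zero assms(2)]] by simp

lemma equiv_rel_cong: "equiv (span_words W) (rel_cong W S)"
proof (rule equivI)
  show "rel_cong W S \<subseteq> span_words W \<times> span_words W"
    by (auto simp: rel_cong_def)
  show "refl_on (span_words W) (rel_cong W S)"
    by (auto simp: refl_on_def rel_cong_def intro: rel_ideal.zero)
  show "sym (rel_cong W S)"
  proof (rule symI)
    fix f h assume *: "(f, h) \<in> rel_cong W S"
    then have "f - h \<in> rel_ideal W S"
      by (simp add: rel_cong_def)
    from rel_ideal.diff[OF rel_ideal.zero this] have "h - f \<in> rel_ideal W S"
      by simp
    with * show "(h, f) \<in> rel_cong W S"
      by (simp add: rel_cong_def)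
  qed
  show "trans (rel_cong W S)"
  proof (rule transI)
    fix f h k assume *: "(f, h) \<in> rel_cong W S" "(h, k) \<in> rel_cong W S"
    then have "(f - h) + (h - k) \<in> rel_ideal W S"
      by (intro rel_ideal_add) (simp_all add: rel_cong_def)
    with * show "(f, k) \<in> rel_cong W S"
      by (simp add: rel_cong_def)
  qed
qed

lemma presented_algebra_add:
  assumes "f \<in> span_words W" and "h \<in> span_words W"
  shows "aadd (presented_algebra W S) (rel_cong W S `` {f}) (rel_cong W S `` {h}) =
    rel_cong W S `` {f + h}"
proof -
  have "congruent2 (rel_cong W S) (rel_cong W S) (\<lambda>a b. rel_cong W S `` {a + b})"
  proof (rule congruent2I')
    fix a a' b b' assume *: "(a, a') \<in> rel_cong W S" "(b, b') \<in> rel_cong W S"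
    then have "(a - a') + (b - b') \<in> rel_ideal W S"
      by (intro rel_ideal_add) (simp_all add: rel_cong_def)
    with * have "(a + b, a' + b') \<in> rel_cong W S"
      by (simp add: rel_cong_def span_words_add algebra_simps)
    then show "rel_cong W S `` {a + b} = rel_cong W S `` {a' + b'}"
      by (rule equiv_class_eq[OF equiv_rel_cong])
  qed
  from UN_equiv_class2[OF equiv_rel_cong equiv_rel_cong this assms]
  show ?thesis by (simp add: presented_algebra_def)
qed

lemma presented_algebra_mult:
  assumes W: "\<And>u v. u \<in> W \<Longrightarrow> v \<in> W \<Longrightarrow> u + v \<in> W"
    and "f \<in> span_words W" and "h \<in> span_words W"
  shows "amult (presented_algebra W S) (rel_cong W S `` {f}) (rel_cong W S `` {h}) =
    rel_cong W S `` {f * h}"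
proof -
  have "congruent2 (rel_cong W S) (rel_cong W S) (\<lambda>a b. rel_cong W S `` {a * b})"
  proof (rule congruent2I')
    fix a a' b b' assume *: "(a, a') \<in> rel_cong W S" "(b, b') \<in> rel_cong W S"
    then have "(a - a') * b + a' * (b - b') \<in> rel_ideal W S"
      by (intro rel_ideal_add rel_ideal.mult_left rel_ideal.mult_right)
         (simp_all add: rel_cong_def)
    moreover have "(a - a') * b + a' * (b - b') = a * b - a' * b'"
      by (simp add: algebra_simps)
    ultimately have "(a * b, a' * b') \<in> rel_cong W S"
      using * by (simp add: rel_cong_def span_words_mult[OF W])
    then show "rel_cong W S `` {a * b} = rel_cong W S `` {a' * b'}"
      by (rule equiv_class_eq[OF equiv_rel_cong])
  qed
  from UN_equiv_class2[OF equiv_rel_cong equiv_rel_cong this assms(2,3)]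
  show ?thesis by (simp add: presented_algebra_def)
qed

lemma presented_algebra_lscale:
  assumes "f \<in> span_words W"
  shows "lscale (presented_algebra W S) c (rel_cong W S `` {f}) = rel_cong W S `` {coef c * f}"
proof -
  have "congruent (rel_cong W S) (\<lambda>a. rel_cong W S `` {coef c * a})"
  proof (rule congruentI)
    fix a a' assume *: "(a, a') \<in> rel_cong W S"
    then have "coef c * (a - a') \<in> rel_ideal W S"
      by (intro rel_ideal.coef_left) (simp add: rel_cong_def)
    with * have "(coef c * a, coef c * a') \<in> rel_cong W S"
      by (simp add: rel_cong_def span_words_coef right_diff_distrib)
    then show "rel_cong W S `` {coef c * a} = rel_cong W S `` {coef c * a'}"
      by (rule equiv_class_eq[OF equiv_rel_cong])
  qed
  from UN_equiv_class[OF equiv_rel_cong this assms]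
  show ?thesis by (simp add: presented_algebra_def)
qed

lemma presented_algebra_rscale:
  assumes "f \<in> span_words W"
  shows "rscale (presented_algebra W S) (rel_cong W S `` {f}) c = rel_cong W S `` {f * coef c}"
proof -
  have "congruent (rel_cong W S) (\<lambda>a. rel_cong W S `` {a * coef c})"
  proof (rule congruentI)
    fix a a' assume *: "(a, a') \<in> rel_cong W S"
    then have "(a - a') * coef c \<in> rel_ideal W S"
      by (intro rel_ideal.coef_right) (simp add: rel_cong_def)
    with * have "(a * coef c, a' * coef c) \<in> rel_cong W S"
      by (simp add: rel_cong_def span_words_coef left_diff_distrib)
    then show "rel_cong W S `` {a * coef c} = rel_cong W S `` {a' * coef c}"
      by (rule equiv_class_eq[OF equiv_rel_cong])
  qed
  from UN_equiv_class[OF equiv_rel_cong this assms]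
  show ?thesis by (simp add: presented_algebra_def)
qed

end

theory Submission
  imports Defs "HOL-Library.Sublist"
begin

text \<open>
  Write \<open>x\<^sub>a\<close> for the product of letters \<open>X1\<close>, \<open>X2\<close> spelled by a bit string \<open>a\<close>, and \<open>x\<^sub>a\<^sup>*\<close> for
  the reversed product of starred letters.  In the Leavitt algebra the monomials
  \<open>[a, b] = x\<^sub>a x\<^sub>b\<^sup>*\<close> multiply like matrix units: \<open>[a, b] [b, d] = [a, d]\<close>, and \<open>[a, b] [c, d] = 0\<close>
  if neither of \<open>b\<close>, \<open>c\<close> is a prefix of the other.  Choose a prefix code \<open>v \<mapsto> w\<^sub>v\<close> on the
  vertices and, for each vertex \<open>v\<close> that emits edges, a prefix code \<open>e \<mapsto> u\<^sub>e\<close> on the edges with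
  source \<open>v\<close> that is complete in the sense that \<open>\<Sum>\<^sub>e [u\<^sub>e, u\<^sub>e] = 1\<close>.  Then
  \<open>v \<mapsto> [w\<^sub>v, w\<^sub>v]\<close>, \<open>e \<mapsto> [w\<^bsub>s(e)\<^esub> u\<^sub>e, w\<^bsub>r(e)\<^esub>]\<close>, \<open>e\<^sup>* \<mapsto> [w\<^bsub>r(e)\<^esub>, w\<^bsub>s(e)\<^esub> u\<^sub>e]\<close> respects the
  defining relations of the Leavitt path algebra (\<open>subst_rel_ideal\<close>).

  Condition (L) gives injectivity, in two steps.

  First, an element \<open>f\<close> vanishes as soon as \<open>f \<beta>\<close> does for all paths \<open>\<beta>\<close> that have length at least
  \<open>n\<close> or end in a sink: the sum of the vertices is a local unit, and the last relation lets one
  prolong any path that does not end in a sink (\<open>mem_ideal_if_long_paths_mem\<close>).  If \<open>n\<close> bounds the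
  length of the words in \<open>f\<close>, then \<open>\<beta>\<close> absorbs all ghost edges, and \<open>f \<beta>\<close> is a linear combination
  of real paths with the same range \<open>r\<close> as \<open>\<beta>\<close> (\<open>mult_path_reduces\<close>).

  Second, a path \<open>e\<^sub>1 \<dots> e\<^sub>n\<close> from \<open>v\<close> to \<open>r\<close> is sent to \<open>[w\<^sub>v u\<^sub>1 \<dots> u\<^sub>n, w\<^sub>r]\<close>, where
  \<open>u\<^sub>i\<close> is the code of \<open>e\<^sub>i\<close>.  By the prefix property, two distinct paths to \<open>r\<close> can only have the same code if one prolongs the other by a
  closed walk all of whose edges have empty code.  An edge has empty code only if it is the only
  one its source emits, so that such a walk contains a cycle without exit, which condition (L)
  forbids (\<open>walks_with_same_code\<close>).  The images of distinct paths to \<open>r\<close> are therefore linearly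
  independent, as the action of the Leavitt algebra on functions on the natural numbers shows
  in which \<open>X1\<close> and \<open>X2\<close> move the indicator function of \<open>n\<close> to those of \<open>2 n\<close> and
  \<open>2 n + 1\<close> (\<open>path_combination_eq_zero\<close>).
\<close>

section \<open>Linear extension of maps defined on words\<close>

lemma free_alg_span_induct [consumes 1, case_names zero single add]:
  fixes f :: "'w \<Rightarrow>\<^sub>0 'r::comm_monoid_add"
  assumes "Poly_Mapping.keys f \<subseteq> W"
    and "P 0"
    and "\<And>w c. w \<in> W \<Longrightarrow> P (Poly_Mapping.single w c)"
    and "\<And>f h. P f \<Longrightarrow> P h \<Longrightarrow> P (f + h)"
  shows "P f"
proof -
  have "P (\<Sum>w\<in>K. Poly_Mapping.single w (Poly_Mapping.lookup f w))" if "finite K" "K \<subseteq> W" for K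
    using that by (induction K) (auto intro: assms)
  moreover have "f = (\<Sum>w\<in>Poly_Mapping.keys f. Poly_Mapping.single w (Poly_Mapping.lookup f w))"
    by (rule poly_mapping_eqI)
       (auto simp: lookup_sum lookup_single when_def in_keys_iff)
  ultimately show ?thesis
    using assms(1) by (metis finite_keys)
qed

lemmas free_alg_induct [case_names zero single add] = free_alg_span_induct[OF subset_UNIV]

text \<open>
  Both the substitution of words for letters and the action on functions arise by extending a
  family of additive maps, one for each word, to all finite combinations of words.
\<close>

definition lin_ext :: "('w \<Rightarrow> 'r \<Rightarrow> 'a) \<Rightarrow> ('w \<Rightarrow>\<^sub>0 'r::zero) \<Rightarrow> 'a::comm_monoid_add" where
  "lin_ext F f = (\<Sum>w\<in>Poly_Mapping.keys f. F w (Poly_Mapping.lookup f w))"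

lemma lin_ext_zero [simp]: "lin_ext F 0 = 0"
  by (simp add: lin_ext_def)

lemma lin_ext_single: "F w 0 = 0 \<Longrightarrow> lin_ext F (Poly_Mapping.single w c) = F w c"
  by (simp add: lin_ext_def)

lemma lin_ext_add:
  fixes f h :: "'w \<Rightarrow>\<^sub>0 'r::comm_monoid_add"
  assumes "\<And>w. F w 0 = 0" and "\<And>w a b. F w (a + b) = F w a + F w b"
  shows "lin_ext F (f + h) = lin_ext F f + lin_ext F h"
proof -
  let ?K = "Poly_Mapping.keys f \<union> Poly_Mapping.keys h"
  have *: "lin_ext F g = (\<Sum>w\<in>?K. F w (Poly_Mapping.lookup g w))"
    if "Poly_Mapping.keys g \<subseteq> ?K" for g
    unfolding lin_ext_def using that
    by (intro sum.mono_neutral_left) (auto simp: in_keys_iff assms(1))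
  show ?thesis
    using Poly_Mapping.keys_add[of f h]
    by (simp add: * lookup_add assms(2) sum.distrib)
qed

definition push :: "('v \<Rightarrow> 'w) \<Rightarrow> ('v \<Rightarrow>\<^sub>0 'r) \<Rightarrow> ('w \<Rightarrow>\<^sub>0 'r::comm_monoid_add)" where
  "push h = lin_ext (\<lambda>w. Poly_Mapping.single (h w))"

lemma push_zero [simp]: "push h 0 = 0"
  by (simp add: push_def)

lemma push_single [simp]: "push h (Poly_Mapping.single w c) = Poly_Mapping.single (h w) c"
  by (simp add: push_def lin_ext_single)

lemma push_add [simp]: "push h (f + g) = push h f + push h g"
  by (simp add: push_def lin_ext_add single_add)

lemma push_diff [simp]: "push h (f - g) = push h f - push h g"
  for f g :: "'v \<Rightarrow>\<^sub>0 'r::ab_group_add"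
  using push_add[of h "f - g" g] by (simp add: algebra_simps)

lemma push_sum: "push h (sum F A) = (\<Sum>a\<in>A. push h (F a))"
  by (induction A rule: infinite_finite_induct) simp_all

lemma push_mult:
  fixes f g :: "'v::monoid_add \<Rightarrow>\<^sub>0 'r::ring"
  assumes h: "\<And>u v. h (u + v) = h u + h v"
  shows "push h (f * g) = push h f * push h g"
proof (induction f rule: free_alg_induct)
  case (single u a)
  show ?case
    by (induction g rule: free_alg_induct) (simp_all add: h mult_single distrib_left)
qed (simp_all add: distrib_right)

section \<open>Congruence modulo relations\<close>

abbreviation mon :: "'g list \<Rightarrow> ('g, 'r::{ring, monoid_mult}) free_alg" where
  "mon ls \<equiv> Poly_Mapping.single (Word ls) 1"

lemma gen_eq_mon: "gen g = mon [g]"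
  by (simp add: gen_def)

lemma coef_one_eq_mon: "coef 1 = mon []"
  by (simp add: coef_def zero_word_def)

lemma mon_mult: "mon a * mon b = mon (a @ b)"
  by (simp add: mult_single plus_word_def)

lemma mon_Nil_mult [simp]: "mon [] * f = f" "f * mon [] = f"
  by (induction f rule: free_alg_induct)
     (simp_all add: mult_single distrib_left distrib_right flip: zero_word_def)

definition rel_eq where
  "rel_eq W S f h \<longleftrightarrow> f - h \<in> rel_ideal W S"

lemma rel_eq_refl [simp]: "rel_eq W S f f"
  by (simp add: rel_eq_def rel_ideal.zero)

lemma rel_eq_zero: "rel_eq W S f 0 \<longleftrightarrow> f \<in> rel_ideal W S"
  by (simp add: rel_eq_def)

lemma rel_eq_sym: "rel_eq W S f h \<Longrightarrow> rel_eq W S h f"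
  using rel_ideal.diff[OF rel_ideal.zero, of "f - h"] by (auto simp: rel_eq_def)

lemma rel_eq_trans [trans]: "rel_eq W S f h \<Longrightarrow> rel_eq W S h k \<Longrightarrow> rel_eq W S f k"
  using rel_ideal_add[of "f - h" W S "h - k"] by (auto simp: rel_eq_def)

lemma rel_eq_rel: "(a, b) \<in> S \<Longrightarrow> rel_eq W S a b"
  by (simp add: rel_eq_def rel_ideal.base)

lemma rel_eq_add: "rel_eq W S f h \<Longrightarrow> rel_eq W S f' h' \<Longrightarrow> rel_eq W S (f + f') (h + h')"
  using rel_ideal_add[of "f - h" W S "f' - h'"] by (simp add: rel_eq_def algebra_simps)

lemma rel_eq_sum:
  "(\<And>a. a \<in> A \<Longrightarrow> rel_eq W S (F a) (H a)) \<Longrightarrow> rel_eq W S (sum F A) (sum H A)"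
  by (induction A rule: infinite_finite_induct) (simp_all add: rel_eq_add)

lemma rel_eq_mem: "rel_eq W S f h \<Longrightarrow> f \<in> rel_ideal W S \<longleftrightarrow> h \<in> rel_ideal W S"
  using rel_eq_trans rel_eq_sym rel_eq_zero by metis

lemma unital_words_UNIV [simp]: "unital_words UNIV = UNIV"
  by (simp add: unital_words_def)

lemma span_words_UNIV [simp]: "span_words UNIV = UNIV"
  by (simp add: span_words_def)

lemma span_words_mono: "V \<subseteq> W \<Longrightarrow> span_words V \<subseteq> span_words W"
  by (auto simp: span_words_def)

lemma nonunital_subset_unital: "nonunital_words X \<subseteq> unital_words X"
  by (auto simp: nonunital_words_def unital_words_def)

text \<open>
  The closure rules under coefficients supply exactly the multiples of the empty word.  So even
  an ideal of an algebra without unit absorbs multiplication by combinations of all words,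
  and a relation can be applied at an end of a word, where the context on one side is empty.
\<close>

lemma rel_ideal_mult_unital:
  assumes W: "nonunital_words X \<subseteq> W"
    and f: "f \<in> rel_ideal W S" and h: "h \<in> span_words (unital_words X)"
  shows "h * f \<in> rel_ideal W S" and "f * h \<in> rel_ideal W S"
proof -
  have keys: "Poly_Mapping.keys h \<subseteq> unital_words X"
    using h by (simp add: span_words_def)
  have single: "Poly_Mapping.single w c * f \<in> rel_ideal W S \<and>
      f * Poly_Mapping.single w c \<in> rel_ideal W S" if "w \<in> unital_words X" for w c
  proof (cases "letters w = []")
    case True
    then have "Poly_Mapping.single w c = coef c"
      by (cases w) (simp add: coef_def zero_word_def)
    then show ?thesis
      using f by (simp add: rel_ideal.coef_left rel_ideal.coef_right)
  next
    case False
    then have "Poly_Mapping.single w c \<in> span_words W"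
      using that W by (auto simp: span_words_def unital_words_def nonunital_words_def)
    then show ?thesis
      using f by (simp add: rel_ideal.mult_left rel_ideal.mult_right)
  qed
  show "h * f \<in> rel_ideal W S" using keys
    by (rule free_alg_span_induct)
       (simp_all add: single rel_ideal.zero distrib_right rel_ideal_add)
  show "f * h \<in> rel_ideal W S" using keys
    by (rule free_alg_span_induct)
       (simp_all add: single rel_ideal.zero distrib_left rel_ideal_add)
qed

lemma rel_eq_mult:
  assumes "nonunital_words X \<subseteq> W" "rel_eq W S f h" "k \<in> span_words (unital_words X)"
  shows "rel_eq W S (k * f) (k * h)" "rel_eq W S (f * k) (h * k)"
  using rel_ideal_mult_unital[OF assms(1) assms(2)[unfolded rel_eq_def] assms(3)]
  by (simp_all add: rel_eq_def algebra_simps)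

section \<open>Monomials of the Leavitt algebra\<close>

abbreviation leavitt_eq (infix "\<approx>" 50) where
  "leavitt_eq \<equiv> rel_eq UNIV leavitt_rels"

lemma leavitt_eq_context:
  "f \<approx> h \<Longrightarrow> mon a * f * mon b \<approx> mon a * h * mon b"
  by (rule rel_eq_mult(2)[where X = UNIV], simp, rule rel_eq_mult(1)[where X = UNIV]) simp_all

definition xletter :: "bool \<Rightarrow> leavitt_gen" where
  "xletter b = (if b then X2 else X1)"

definition xletter_star :: "bool \<Rightarrow> leavitt_gen" where
  "xletter_star b = (if b then X2s else X1s)"

definition xword :: "bool list \<Rightarrow> leavitt_gen list" where
  "xword a = map xletter a"

definition xstar :: "bool list \<Rightarrow> leavitt_gen list" where
  "xstar a = rev (map xletter_star a)"

abbreviation xmon :: "bool list \<Rightarrow> bool list \<Rightarrow> (leavitt_gen, 'r::{ring, monoid_mult}) free_alg" where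
  "xmon a b \<equiv> mon (xword a @ xstar b)"

lemma xword_simps [simp]: "xword [] = []" "xword (a @ b) = xword a @ xword b"
  "xword (x # a) = xletter x # xword a"
  by (simp_all add: xword_def)

lemma xstar_simps [simp]: "xstar [] = []" "xstar (a @ b) = xstar b @ xstar a"
  "xstar (x # a) = xstar a @ [xletter_star x]"
  by (simp_all add: xstar_def)

lemma xstar_xword_step:
  "mon (xstar (x # a) @ xword (y # b)) \<approx> (if x = y then mon (xstar a @ xword b) else 0)"
proof -
  have *: "mon (xstar (x # a) @ xword (y # b)) =
      mon (xstar a) * (gen (xletter_star x) * gen (xletter y)) * mon (xword b)"
    by (simp add: gen_eq_mon mon_mult)
  have "gen (xletter_star x) * gen (xletter y) \<approx> (if x = y then mon [] else 0)"
    by (rule rel_eq_rel)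
       (simp add: leavitt_rels_def coef_one_eq_mon xletter_def xletter_star_def)
  from leavitt_eq_context[OF this, of "xstar a" "xword b"]
  show ?thesis
    unfolding * by (auto simp: mon_mult split: if_splits)
qed

text \<open>
  A common prefix cancels from the inside outwards, because the starred word is reversed.
\<close>

lemma xstar_xword_append:
  "mon (xstar (p @ a) @ xword (p @ b)) \<approx> mon (xstar a @ xword b)"
proof (induction p)
  case (Cons x p)
  show ?case
    using rel_eq_trans[OF xstar_xword_step[of x "p @ a" x "p @ b"]] Cons.IH by simp
qed simp

lemma xstar_xword_parallel:
  assumes "a \<parallel> b"
  shows "mon (xstar a @ xword b) \<approx> 0"
proof -
  from parallel_decomp[OF assms] obtain p x y c d
    where *: "x \<noteq> y" "a = p @ x # c" "b = p @ y # d" by blast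
  have "mon (xstar a @ xword b) \<approx> mon (xstar (x # c) @ xword (y # d))"
    unfolding *(2,3) by (rule xstar_xword_append)
  also have "\<dots> \<approx> 0"
    using xstar_xword_step[of x c y d] *(1) by simp
  finally show ?thesis .
qed

lemma xmon_mult_right_longer: "xmon a b * xmon (b @ c) d \<approx> xmon (a @ c) d"
  using leavitt_eq_context[OF xstar_xword_append[of b "[]" c], of "xword a" "xstar d"]
  by (simp add: mon_mult)

lemma xmon_mult_left_longer: "xmon a (b @ c) * xmon b d \<approx> xmon a (d @ c)"
  using leavitt_eq_context[OF xstar_xword_append[of b c "[]"], of "xword a" "xstar d"]
  by (simp add: mon_mult)

lemma xmon_mult_same: "xmon a b * xmon b d \<approx> xmon a d"
  using xmon_mult_right_longer[of a b "[]" d] by simp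

lemma xmon_mult_parallel: "b \<parallel> c \<Longrightarrow> xmon a b * xmon c d \<approx> 0"
  using leavitt_eq_context[OF xstar_xword_parallel[of b c], of "xword a" "xstar d"]
  by (simp add: mon_mult)

text \<open>
  A comb: the code of a larger set splits off one element at the bit \<open>0\<close> and puts the code of
  the others below the bit \<open>1\<close>.  Completeness persists since \<open>X1 X1\<^sup>* + X2 X2\<^sup>* = 1\<close>.  A
  singleton must get the empty code, which is the only obstruction to injectivity later on.
\<close>

lemma complete_prefix_code_exists:
  assumes "finite A" and "A \<noteq> {}"
  shows "\<exists>u. (\<forall>a\<in>A. \<forall>b\<in>A. a \<noteq> b \<longrightarrow> u a \<parallel> u b) \<and>
    (\<Sum>a\<in>A. xmon (u a) (u a) :: (leavitt_gen, 'r::{ring, monoid_mult}) free_alg) \<approx> mon []"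
  using assms
proof (induction A rule: finite_ne_induct)
  case (singleton a)
  show ?case
    by (rule exI[of _ "\<lambda>_. []"]) simp
next
  case (insert a A)
  then obtain u where u: "\<forall>a\<in>A. \<forall>b\<in>A. a \<noteq> b \<longrightarrow> u a \<parallel> u b"
    and sum: "(\<Sum>a\<in>A. xmon (u a) (u a) :: (leavitt_gen, 'r) free_alg) \<approx> mon []" by blast
  define u' where "u' x = (if x = a then [False] else True # u x)" for x
  have "(\<Sum>x\<in>A. xmon (u' x) (u' x) :: (leavitt_gen, 'r) free_alg) =
      (\<Sum>x\<in>A. mon [X2] * xmon (u x) (u x) * mon [X2s])"
    using insert.hyps
    by (intro sum.cong) (auto simp: u'_def mon_mult xletter_def xletter_star_def)
  then have "(\<Sum>x\<in>insert a A. xmon (u' x) (u' x) :: (leavitt_gen, 'r) free_alg) =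
      mon [X1, X1s] + (\<Sum>x\<in>A. mon [X2] * xmon (u x) (u x) * mon [X2s])"
    using insert.hyps by (simp add: u'_def xletter_def xletter_star_def)
  also have "\<dots> = mon [X1, X1s] + mon [X2] * (\<Sum>x\<in>A. xmon (u x) (u x)) * mon [X2s]"
    by (simp add: sum_distrib_left sum_distrib_right)
  also have "\<dots> \<approx> mon [X1, X1s] + mon [X2] * mon [] * mon [X2s]"
    by (intro rel_eq_add rel_eq_refl leavitt_eq_context sum)
  also have "\<dots> = gen X1 * gen X1s + gen X2 * gen X2s"
    by (simp add: gen_eq_mon mon_mult)
  also have "\<dots> \<approx> mon []"
    by (rule rel_eq_rel) (simp add: leavitt_rels_def coef_one_eq_mon)
  finally have "(\<Sum>x\<in>insert a A. xmon (u' x) (u' x) :: (leavitt_gen, 'r) free_alg) \<approx> mon []" .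
  moreover have "\<forall>x\<in>insert a A. \<forall>y\<in>insert a A. x \<noteq> y \<longrightarrow> u' x \<parallel> u' y"
    using u insert.hyps by (auto simp: u'_def parallel_def)
  ultimately show ?case by blast
qed

section \<open>A representation of the Leavitt algebra\<close>

text \<open>
  The maps \<open>n \<mapsto> 2 n\<close> and \<open>n \<mapsto> 2 n + 1\<close> are injective and their images partition the natural
  numbers, which is what the defining relations ask for.  The letters \<open>X1\<close>, \<open>X2\<close> push functions
  forward along these maps, and the starred letters pull them back.
\<close>

fun letter_act :: "leavitt_gen \<Rightarrow> (nat \<Rightarrow> 'r::zero) \<Rightarrow> nat \<Rightarrow> 'r" where
  "letter_act X1 m n = (if even n then m (n div 2) else 0)"
| "letter_act X2 m n = (if odd n then m (n div 2) else 0)"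
| "letter_act X1s m n = m (2 * n)"
| "letter_act X2s m n = m (2 * n + 1)"

definition word_act :: "leavitt_gen word \<Rightarrow> (nat \<Rightarrow> 'r::zero) \<Rightarrow> nat \<Rightarrow> 'r" where
  "word_act w = foldr letter_act (letters w)"

definition act :: "(leavitt_gen, 'r::ring) free_alg \<Rightarrow> (nat \<Rightarrow> 'r) \<Rightarrow> nat \<Rightarrow> 'r" where
  "act f m n = lin_ext (\<lambda>w c. c * word_act w m n) f"

lemma word_act_add:
  "word_act w (\<lambda>n. m n + m' n) = (\<lambda>n. word_act w m n + word_act w m' n)"
  for m :: "nat \<Rightarrow> 'r::monoid_add"
proof -
  have *: "letter_act g (\<lambda>n. m n + m' n) = (\<lambda>n. letter_act g m n + letter_act g m' n)"
    for g and m m' :: "nat \<Rightarrow> 'r" by (cases g) auto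
  have "foldr letter_act ls (\<lambda>n. m n + m' n) =
      (\<lambda>n. foldr letter_act ls m n + foldr letter_act ls m' n)" for ls
    by (induction ls) (simp_all add: *)
  then show ?thesis by (simp add: word_act_def)
qed

lemma word_act_scale: "word_act w (\<lambda>n. c * m n) = (\<lambda>n. c * word_act w m n)"
  for c :: "'r::mult_zero"
proof -
  have *: "letter_act g (\<lambda>n. c * m n) = (\<lambda>n. c * letter_act g m n)"
    for g and m :: "nat \<Rightarrow> 'r" by (cases g) auto
  have "foldr letter_act ls (\<lambda>n. c * m n) = (\<lambda>n. c * foldr letter_act ls m n)" for ls
    by (induction ls) (simp_all add: *)
  then show ?thesis by (simp add: word_act_def)
qed

lemma word_act_zero: "word_act w (\<lambda>n. 0 :: 'r::mult_zero) = (\<lambda>n. 0)"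
  using word_act_scale[of w 0 "\<lambda>n. 0 :: 'r"] by simp

lemma act_zero [simp]: "act 0 m n = 0"
  by (simp add: act_def)

lemma act_single: "act (Poly_Mapping.single w c) m n = c * word_act w m n"
  by (simp add: act_def lin_ext_single)

lemma act_add: "act (f + h) m n = act f m n + act h m n"
  by (simp add: act_def lin_ext_add distrib_right)

lemma act_diff: "act (f - h) m n = act f m n - act h m n"
  using act_add[of "f - h" h m n] by (simp add: algebra_simps)

lemma act_zero_right: "act f (\<lambda>n. 0) n = 0"
  by (simp add: act_def lin_ext_def word_act_zero)

lemma act_mult: "act (f * h) m n = act f (act h m) n"
proof (induction f arbitrary: n rule: free_alg_induct)
  case (single u a)
  have "act (Poly_Mapping.single u a * h) m n = a * word_act u (act h m) n"
  proof (induction h arbitrary: n rule: free_alg_induct)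
    case zero
    have "act 0 m = (\<lambda>n. 0)" by (rule ext) simp
    then show ?case by (simp add: word_act_zero)
  next
    case (single v b)
    have "act (Poly_Mapping.single v b) m = (\<lambda>n. b * word_act v m n)"
      by (rule ext) (rule act_single)
    then show ?case
      by (simp add: mult_single act_single word_act_scale mult.assoc)
         (simp add: word_act_def plus_word_def)
  next
    case (add f h)
    have "act (f + h) m = (\<lambda>n. act f m n + act h m n)"
      by (rule ext) (rule act_add)
    then show ?case
      using add by (simp add: distrib_left act_add word_act_add)
  qed
  then show ?case by (simp add: act_single)
qed (simp_all add: distrib_right act_add)

lemma act_mon: "act (mon ls) m n = word_act (Word ls) m n"
  by (simp add: act_single)

lemma act_rel_ideal:
  "f \<in> rel_ideal UNIV leavitt_rels \<Longrightarrow> act f m n = 0"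
proof (induction f arbitrary: m n rule: rel_ideal.induct)
  case (base a b)
  have "n div 2 * 2 = n" if "even n" using that by simp
  moreover have "Suc (n div 2 * 2) = n" if "odd n"
    using that by (metis odd_two_times_div_two_succ Suc_eq_plus1 mult.commute)
  ultimately show ?case
    using base
    by (auto simp: leavitt_rels_def gen_eq_mon coef_one_eq_mon mon_mult act_add act_diff act_mon
        word_act_def mult.commute)
next
  case (mult_left f h)
  then have "act f m = (\<lambda>n. 0)" by auto
  then show ?case by (simp add: act_mult act_zero_right)
next
  case (coef_left f c)
  then have "act f m = (\<lambda>n. 0)" by auto
  then show ?case by (simp add: act_mult act_zero_right)
qed (simp_all add: act_mult act_diff)

text \<open>
  The binary numeral with digits \<open>a\<close>, least significant first, and a leading \<open>1\<close>.  It is the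
  number to which the word \<open>x\<^sub>a\<close> moves \<open>1\<close>; the leading digit makes the length of \<open>a\<close>
  recoverable, so that distinct words move \<open>1\<close> to distinct numbers.
\<close>

definition numeral_of :: "bool list \<Rightarrow> nat" where
  "numeral_of a = foldr (\<lambda>b n. 2 * n + of_bool b) a 1"

lemma numeral_of_simps [simp]:
  "numeral_of [] = 1" "numeral_of (x # a) = 2 * numeral_of a + of_bool x"
  by (simp_all add: numeral_of_def)

lemma numeral_of_pos: "numeral_of a > 0"
  by (induction a) auto

lemma inj_numeral_of: "inj numeral_of"
proof (rule injI)
  show "a = b" if "numeral_of a = numeral_of b" for a b
    using that
  proof (induction a arbitrary: b)
    case Nil
    then show ?case using numeral_of_pos[of "tl b"] by (cases b) auto
  next
    case (Cons x a)
    note IH = Cons.IH and eq = Cons.prems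
    show ?case
    proof (cases b)
      case Nil
      then show ?thesis using eq numeral_of_pos[of a] by auto
    next
      case (Cons y b')
      have "x = y \<and> numeral_of a = numeral_of b'"
        using eq unfolding Cons numeral_of_simps by (cases x; cases y) (simp_all, presburger+)
      then show ?thesis using IH Cons by simp
    qed
  qed
qed

abbreviation unit_at :: "nat \<Rightarrow> nat \<Rightarrow> 'r::{ring, monoid_mult}" where
  "unit_at k n \<equiv> (if n = k then 1 else 0)"

lemma word_act_xmon:
  "word_act (Word (xword a @ xstar b)) (unit_at (numeral_of (b @ c))) =
    (unit_at (numeral_of (a @ c)) :: nat \<Rightarrow> 'r::{ring, monoid_mult})"
proof -
  have "foldr letter_act (xstar b) (unit_at (numeral_of (b @ c))) =
      (unit_at (numeral_of c) :: nat \<Rightarrow> 'r)"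
  proof (induction b)
    case (Cons x b)
    have "letter_act (xletter_star x) (unit_at (numeral_of ((x # b) @ c))) =
        (unit_at (numeral_of (b @ c)) :: nat \<Rightarrow> 'r)"
      by (rule ext) (auto simp: xletter_star_def)
    then show ?case using Cons by (simp del: numeral_of_simps)
  qed simp
  moreover have "foldr letter_act (xword a) (unit_at (numeral_of c)) =
      (unit_at (numeral_of (a @ c)) :: nat \<Rightarrow> 'r)"
  proof (induction a)
    case (Cons x a)
    have "letter_act (xletter x) (unit_at (numeral_of (a @ c))) =
        (unit_at (numeral_of ((x # a) @ c)) :: nat \<Rightarrow> 'r)"
      by (rule ext) (auto simp: xletter_def elim!: oddE)
    then show ?case using Cons by (simp del: numeral_of_simps)
  qed simp
  ultimately show ?thesis by (simp add: word_act_def)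
qed

section \<open>Reduction to real paths in the Leavitt path algebra\<close>

abbreviation lpa_eq :: "('v, 'e) pre_digraph \<Rightarrow>
    (('v, 'e) lpa_gen, 'r::{ring, monoid_mult}) free_alg \<Rightarrow> (('v, 'e) lpa_gen, 'r) free_alg \<Rightarrow> bool"
  where "lpa_eq E \<equiv> rel_eq (nonunital_words (lpa_gens E)) (lpa_rels E)"

context fin_digraph
begin

lemma lpa_eq_mult:
  "lpa_eq G f h \<Longrightarrow> k \<in> span_words (unital_words (lpa_gens G)) \<Longrightarrow> lpa_eq G (k * f) (k * h)"
  "lpa_eq G f h \<Longrightarrow> k \<in> span_words (unital_words (lpa_gens G)) \<Longrightarrow> lpa_eq G (f * k) (h * k)"
  by (rule rel_eq_mult[OF subset_refl]; assumption)+

lemma single_in_unital_span: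
  "set ls \<subseteq> lpa_gens G \<Longrightarrow>
    Poly_Mapping.single (Word ls) c \<in> span_words (unital_words (lpa_gens G))"
  by (simp add: span_words_def unital_words_def)

lemma lpa_eq_mult_mon:
  "lpa_eq G f h \<Longrightarrow> set ls \<subseteq> lpa_gens G \<Longrightarrow> lpa_eq G (mon ls * f) (mon ls * h)"
  "lpa_eq G f h \<Longrightarrow> set ls \<subseteq> lpa_gens G \<Longrightarrow> lpa_eq G (f * mon ls) (h * mon ls)"
  by (auto intro: lpa_eq_mult single_in_unital_span)

lemma lpa_gens_simps [simp]:
  "Vert v \<in> lpa_gens G \<longleftrightarrow> v \<in> verts G"
  "Edge e \<in> lpa_gens G \<longleftrightarrow> e \<in> arcs G"
  "Ghost e \<in> lpa_gens G \<longleftrightarrow> e \<in> arcs G"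
  by (auto simp: lpa_gens_def)

primrec right_vertex :: "('a, 'b) lpa_gen \<Rightarrow> 'a" where
  "right_vertex (Vert v) = v"
| "right_vertex (Edge e) = head G e"
| "right_vertex (Ghost e) = tail G e"

lemma right_vertex_in_verts: "g \<in> lpa_gens G \<Longrightarrow> right_vertex g \<in> verts G"
  by (cases g) auto

lemma vert_vert:
  assumes "v \<in> verts G" "w \<in> verts G"
  shows "lpa_eq G (mon [Vert v, Vert w]) (if v = w then mon [Vert w] else 0)"
proof -
  have "(gen (Vert v) * gen (Vert w), if v = w then gen (Vert w) else 0) \<in> lpa_rels G"
    using assms unfolding lpa_rels_def by blast
  then show ?thesis by (auto simp: gen_eq_mon mon_mult dest: rel_eq_rel)
qed

lemma tail_edge:
  assumes "e \<in> arcs G"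
  shows "lpa_eq G (mon [Vert (tail G e), Edge e]) (mon [Edge e])"
proof -
  have "(gen (Vert (tail G e)) * gen (Edge e), gen (Edge e)) \<in> lpa_rels G"
    using assms unfolding lpa_rels_def by blast
  then show ?thesis by (auto simp: gen_eq_mon mon_mult dest: rel_eq_rel)
qed

lemma ghost_edge:
  assumes "e \<in> arcs G" "f \<in> arcs G"
  shows "lpa_eq G (mon [Ghost e, Edge f]) (if e = f then mon [Vert (head G e)] else 0)"
proof -
  have "(gen (Ghost e) * gen (Edge f), if e = f then gen (Vert (head G e)) else 0) \<in> lpa_rels G"
    using assms unfolding lpa_rels_def by blast
  then show ?thesis by (auto simp: gen_eq_mon mon_mult dest: rel_eq_rel)
qed

lemma regular_vert:
  assumes "regular_vertex G v"
  shows "lpa_eq G (mon [Vert v]) (\<Sum>e\<in>out_arcs G v. mon [Edge e, Ghost e])"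
proof -
  have "(gen (Vert v), \<Sum>e\<in>out_arcs G v. gen (Edge e) * gen (Ghost e)) \<in> lpa_rels G"
    using assms unfolding lpa_rels_def by blast
  then show ?thesis by (auto simp: gen_eq_mon mon_mult dest: rel_eq_rel)
qed

lemma gen_right_vertex:
  assumes "g \<in> lpa_gens G"
  shows "lpa_eq G (mon [g, Vert (right_vertex g)]) (mon [g])"
proof (cases g)
  case (Vert v)
  then show ?thesis using vert_vert[of v v] assms by auto
next
  case (Edge e)
  with assms have "e \<in> arcs G" by simp
  then have "(gen (Edge e) * gen (Vert (head G e)), gen (Edge e)) \<in> lpa_rels G"
    unfolding lpa_rels_def by blast
  then show ?thesis by (auto simp: Edge gen_eq_mon mon_mult dest: rel_eq_rel)
next
  case (Ghost e)
  with assms have "e \<in> arcs G" by simp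
  then have "(gen (Ghost e) * gen (Vert (tail G e)), gen (Ghost e)) \<in> lpa_rels G"
    unfolding lpa_rels_def by blast
  then show ?thesis by (auto simp: Ghost gen_eq_mon mon_mult dest: rel_eq_rel)
qed

lemma gen_vert:
  assumes g: "g \<in> lpa_gens G" and v: "v \<in> verts G"
  shows "lpa_eq G (mon [g, Vert v]) (if v = right_vertex g then mon [g] else 0)"
proof -
  note r = right_vertex_in_verts[OF g]
  have "lpa_eq G (mon [g, Vert v]) (mon [g, Vert (right_vertex g)] * mon [Vert v])"
    using lpa_eq_mult_mon(2)[OF rel_eq_sym[OF gen_right_vertex[OF g]], of "[Vert v]"] v
    by (simp add: mon_mult)
  also have "\<dots> = mon [g] * mon [Vert (right_vertex g), Vert v]"
    by (simp add: mon_mult)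
  also have "lpa_eq G \<dots> (mon [g] * (if right_vertex g = v then mon [Vert v] else 0))"
    using vert_vert[OF r v] g by (intro lpa_eq_mult_mon) auto
  also have "lpa_eq G \<dots> (if v = right_vertex g then mon [g] else 0)"
    using gen_right_vertex[OF g] by (auto simp: mon_mult)
  finally show ?thesis .
qed

text \<open>
  Only the last letter of a word matters: it has a right unit among the vertices, and the
  other vertices annihilate it.
\<close>

lemma vertices_local_unit:
  assumes f: "f \<in> span_words (nonunital_words (lpa_gens G))"
  shows "lpa_eq G (\<Sum>v\<in>verts G. f * mon [Vert v]) (f :: (_, 'r::{ring, monoid_mult}) free_alg)"
  using f[unfolded span_words_def mem_Collect_eq]
proof (induction rule: free_alg_span_induct)
  case (single w c)
  then obtain ls g where w: "w = Word (ls @ [g])" and ls: "set ls \<subseteq> lpa_gens G"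
    and g: "g \<in> lpa_gens G"
    by (cases w; cases "letters w" rule: rev_cases) (auto simp: nonunital_words_def)
  have split: "Poly_Mapping.single w c = Poly_Mapping.single (Word ls) c * (mon [g] :: (_, 'r) free_alg)"
    by (simp add: w mult_single plus_word_def)
  have "lpa_eq G (\<Sum>v\<in>verts G. mon [g, Vert v])
      (\<Sum>v\<in>verts G. if v = right_vertex g then mon [g] else 0 :: (_, 'r) free_alg)"
    by (intro rel_eq_sum gen_vert g)
  also have "\<dots> = mon [g]"
    using right_vertex_in_verts[OF g] by simp
  finally have "lpa_eq G (Poly_Mapping.single (Word ls) c * (\<Sum>v\<in>verts G. mon [g, Vert v]))
      (Poly_Mapping.single (Word ls) c * (mon [g] :: (_, 'r) free_alg))"
    by (intro lpa_eq_mult single_in_unital_span ls)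
  then show ?case
    by (simp add: split sum_distrib_left mult.assoc mon_mult)
next
  case (add f h)
  then show ?case by (simp add: distrib_right sum.distrib rel_eq_add)
qed simp

text \<open>
  The initial vertex is kept as a letter, so that a path of length \<open>0\<close> is a nonempty word too.
\<close>

definition path_word :: "'a \<Rightarrow> 'b list \<Rightarrow> ('a, 'b) lpa_gen list" where
  "path_word u p = Vert u # map Edge p"

lemma path_word_gens: "awalk u p r \<Longrightarrow> set (path_word u p) \<subseteq> lpa_gens G"
  by (auto simp: path_word_def awalk_def)

definition long_or_maximal :: "nat \<Rightarrow> 'b list \<Rightarrow> 'a \<Rightarrow> bool" where
  "long_or_maximal k p r \<longleftrightarrow> k \<le> length p \<or> out_arcs G r = {}"

text \<open>
  A vertex or an edge either annihilates a path or yields a path again, and a ghost edge removes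
  the first edge or annihilates the path.  A ghost edge \<open>e\<^sup>*\<close> could only survive at a path of
  length \<open>0\<close>; the hypothesis makes that vertex a sink, hence different from the source of \<open>e\<close>.
\<close>

lemma gen_path:
  assumes g: "g \<in> lpa_gens G" and p: "awalk u p r" "long_or_maximal (Suc k) p r"
  shows "lpa_eq G (mon (g # path_word u p)) (0 :: (_, 'r::{ring, monoid_mult}) free_alg) \<or>
    (\<exists>v q. awalk v q r \<and> long_or_maximal k q r \<and>
      lpa_eq G (mon (g # path_word u p)) (mon (path_word v q) :: (_, 'r) free_alg))"
proof -
  have u: "u \<in> verts G" and arcs: "set p \<subseteq> arcs G"
    using p(1) by (auto simp: awalk_def)
  have edges: "set (map Edge p) \<subseteq> lpa_gens G"
    using arcs by auto
  have step: "lpa_eq G (mon (g # path_word u p))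
      ((if u = right_vertex g then mon [g] else 0) * mon (map Edge p) :: (_, 'r) free_alg)"
    using lpa_eq_mult_mon(2)[OF gen_vert[OF g u] edges] by (simp add: mon_mult path_word_def)
  show ?thesis
  proof (cases "u = right_vertex g")
    case False
    with step show ?thesis by simp
  next
    case True
    with step have step: "lpa_eq G (mon (g # path_word u p)) (mon (g # map Edge p) :: (_, 'r) free_alg)"
      by (simp add: mon_mult)
    show ?thesis
    proof (cases g)
      case (Vert v)
      then show ?thesis
        using step p True
        by (intro disjI2 exI[of _ u] exI[of _ p]) (auto simp: path_word_def long_or_maximal_def)
    next
      case (Edge e)
      with g have e: "e \<in> arcs G" by simp
      have "lpa_eq G (mon (g # map Edge p)) (mon (path_word (tail G e) (e # p)) :: (_, 'r) free_alg)"
        using lpa_eq_mult_mon(2)[OF rel_eq_sym[OF tail_edge[OF e]] edges]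
        by (simp add: mon_mult path_word_def Edge)
      moreover have "awalk (tail G e) (e # p) r" "long_or_maximal k (e # p) r"
        using p True Edge e by (auto simp: awalk_Cons_iff long_or_maximal_def)
      ultimately show ?thesis using rel_eq_trans[OF step] by blast
    next
      case (Ghost e)
      with g True have e: "e \<in> arcs G" "u = tail G e" by simp_all
      show ?thesis
      proof (cases p)
        case Nil
        then have "e \<in> out_arcs G r" using p(1) e by (auto simp: awalk_Nil_iff)
        then show ?thesis using p(2) Nil by (auto simp: long_or_maximal_def)
      next
        case (Cons f q)
        then have f: "f \<in> arcs G" "awalk (head G f) q r"
          using p(1) by (auto simp: awalk_Cons_iff)
        have "lpa_eq G (mon (g # map Edge p))
            ((if e = f then mon [Vert (head G e)] else 0) * mon (map Edge q) :: (_, 'r) free_alg)"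
          using lpa_eq_mult_mon(2)[OF ghost_edge[OF e(1) f(1)], of "map Edge q"] edges
          by (simp add: mon_mult Ghost Cons)
        with step have "lpa_eq G (mon (g # path_word u p))
            ((if e = f then mon (path_word (head G e) q) else 0) :: (_, 'r) free_alg)"
          using rel_eq_trans by (auto simp: mon_mult path_word_def split: if_splits)
        moreover have "long_or_maximal k q r"
          using p(2) Cons by (auto simp: long_or_maximal_def)
        ultimately show ?thesis using f(2) by (auto split: if_splits)
      qed
    qed
  qed
qed

lemma word_path:
  assumes "set ls \<subseteq> lpa_gens G" and "awalk u p r" and "long_or_maximal (length ls + k) p r"
  shows "lpa_eq G (mon (ls @ path_word u p)) (0 :: (_, 'r::{ring, monoid_mult}) free_alg) \<or>
    (\<exists>v q. awalk v q r \<and> long_or_maximal k q r \<and>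
      lpa_eq G (mon (ls @ path_word u p)) (mon (path_word v q) :: (_, 'r) free_alg))"
  using assms
proof (induction ls arbitrary: k)
  case Nil
  then show ?case
    by (intro disjI2 exI[of _ u] exI[of _ p]) simp
next
  case (Cons g ls)
  have g: "g \<in> lpa_gens G"
    using Cons.prems by simp
  have mult: "lpa_eq G (mon ((g # ls) @ path_word u p)) (mon [g] * h)"
    if "lpa_eq G (mon (ls @ path_word u p)) h" for h :: "(_, 'r) free_alg"
    using lpa_eq_mult_mon(1)[OF that, of "[g]"] g by (simp add: mon_mult)
  consider "lpa_eq G (mon (ls @ path_word u p)) (0 :: (_, 'r) free_alg)"
    | v q where "awalk v q r" "long_or_maximal (Suc k) q r"
      "lpa_eq G (mon (ls @ path_word u p)) (mon (path_word v q) :: (_, 'r) free_alg)"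
    using Cons.IH[of "Suc k"] Cons.prems by auto
  then show ?case
  proof cases
    case 1
    then show ?thesis using mult[OF 1] by simp
  next
    case 2
    have "lpa_eq G (mon ((g # ls) @ path_word u p)) (mon (g # path_word v q) :: (_, 'r) free_alg)"
      using mult[OF 2(3)] by (simp add: mon_mult)
    then show ?thesis
      using gen_path[OF g 2(1,2), where 'r = 'r] rel_eq_trans by blast
  qed
qed

text \<open>
  Each letter costs at most one edge of the path, so a path that is as long as the longest word
  of \<open>f\<close> turns \<open>f\<close> into a combination of real paths.
\<close>

lemma mult_path_reduces:
  fixes f :: "(('a, 'b) lpa_gen, 'r::{ring, monoid_mult}) free_alg"
  assumes f: "f \<in> span_words {Word ls | ls. set ls \<subseteq> lpa_gens G \<and> length ls \<le> n}"
    and p: "awalk u p r" "long_or_maximal n p r"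
  shows "\<exists>g \<in> span_words {Word (path_word v q) | v q. awalk v q r}.
    lpa_eq G (f * mon (path_word u p)) g"
  using f[unfolded span_words_def mem_Collect_eq]
proof (induction rule: free_alg_span_induct)
  case zero
  show ?case by (rule bexI[of _ 0]) (simp_all add: span_words_zero)
next
  case (single w c)
  then obtain ls where w: "w = Word ls" and ls: "set ls \<subseteq> lpa_gens G" "length ls \<le> n"
    by blast
  have reach: "long_or_maximal (length ls + 0) p r"
    using p(2) ls(2) by (auto simp: long_or_maximal_def)
  have split: "Poly_Mapping.single w c * mon (path_word u p) = Poly_Mapping.single (Word []) c * mon (ls @ path_word u p)"
    by (simp add: w mult_single plus_word_def)
  have mult: "lpa_eq G (Poly_Mapping.single w c * mon (path_word u p)) (Poly_Mapping.single (Word []) c * h)"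
    if "lpa_eq G (mon (ls @ path_word u p)) h" for h
    unfolding split using that by (rule lpa_eq_mult) (simp add: single_in_unital_span)
  from word_path[OF ls(1) p(1) reach, where 'r = 'r] show ?case
  proof (elim disjE exE conjE)
    assume "lpa_eq G (mon (ls @ path_word u p)) (0 :: (_, 'r) free_alg)"
    from mult[OF this] show ?case
      by (intro bexI[of _ 0]) (simp_all add: span_words_zero)
  next
    fix v q assume q: "awalk v q r"
      and "lpa_eq G (mon (ls @ path_word u p)) (mon (path_word v q) :: (_, 'r) free_alg)"
    from mult[OF this(2)] show ?case
      by (intro bexI[of _ "Poly_Mapping.single (Word (path_word v q)) c"])
         (use q in \<open>auto simp: mult_single plus_word_def span_words_def\<close>)
  qed
next
  case (add f h)
  then obtain f' h' where
    "f' \<in> span_words {Word (path_word v q) | v q. awalk v q r}" "lpa_eq G (f * mon (path_word u p)) f'"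
    "h' \<in> span_words {Word (path_word v q) | v q. awalk v q r}" "lpa_eq G (h * mon (path_word u p)) h'"
    by blast
  then show ?case
    by (intro bexI[of _ "f' + h'"]) (simp_all add: distrib_right rel_eq_add span_words_add)
qed

lemma path_right_vertex:
  assumes "awalk u p r"
  shows "lpa_eq G (mon (path_word u p @ [Vert r])) (mon (path_word u p))"
proof -
  define ls g where "ls = butlast (path_word u p)" and "g = last (path_word u p)"
  have split: "path_word u p = ls @ [g]"
    by (simp add: ls_def g_def path_word_def)
  have "right_vertex g = r"
    using assms unfolding g_def path_word_def
    by (cases p rule: rev_cases) (auto simp: awalk_Nil_iff awalk_Cons_iff)
  moreover have "set ls \<subseteq> lpa_gens G" "g \<in> lpa_gens G"
    using path_word_gens[OF assms] unfolding split by auto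
  ultimately show ?thesis
    using lpa_eq_mult_mon(1)[OF gen_right_vertex[of g], of ls] by (simp add: split mon_mult)
qed

text \<open>
  If \<open>r\<close> is regular then \<open>f p = f p r = \<Sum>\<^sub>e (f p e) e\<^sup>*\<close>.
\<close>

lemma mem_ideal_if_extensions_mem:
  assumes p: "awalk u p r" and r: "regular_vertex G r"
    and f: "f \<in> span_words (nonunital_words (lpa_gens G))"
    and ext: "\<And>e. e \<in> out_arcs G r \<Longrightarrow>
      lpa_eq G (f * mon (path_word u (p @ [e]))) (0 :: (_, 'r::{ring, monoid_mult}) free_alg)"
  shows "lpa_eq G (f * mon (path_word u p)) 0"
proof -
  have f': "f \<in> span_words (unital_words (lpa_gens G))"
    using f span_words_mono[OF nonunital_subset_unital] by blast
  have "lpa_eq G (mon (path_word u p)) (mon (path_word u p) * mon [Vert r] :: (_, 'r) free_alg)"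
    using rel_eq_sym[OF path_right_vertex[OF p]] by (simp add: mon_mult)
  also have "lpa_eq G \<dots> (mon (path_word u p) * (\<Sum>e\<in>out_arcs G r. mon [Edge e, Ghost e]))"
    by (intro lpa_eq_mult_mon regular_vert r path_word_gens[OF p])
  also have "\<dots> = (\<Sum>e\<in>out_arcs G r. mon (path_word u (p @ [e])) * mon [Ghost e])"
    by (simp add: sum_distrib_left mon_mult path_word_def)
  finally have "lpa_eq G (f * mon (path_word u p))
      (f * (\<Sum>e\<in>out_arcs G r. mon (path_word u (p @ [e])) * mon [Ghost e]))"
    by (rule lpa_eq_mult(1)[OF _ f'])
  also have "\<dots> = (\<Sum>e\<in>out_arcs G r. f * mon (path_word u (p @ [e])) * mon [Ghost e])"
    by (simp add: sum_distrib_left mult.assoc)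
  also have "lpa_eq G \<dots> (\<Sum>e\<in>out_arcs G r. 0 * mon [Ghost e])"
    by (intro rel_eq_sum lpa_eq_mult_mon ext) auto
  finally show ?thesis by simp
qed

text \<open>
  Downward induction on the length of the path, until the paths of length \<open>0\<close> are reached,
  which add up to a local unit.  In a finite graph a vertex that is not a sink is regular.
\<close>

lemma mem_ideal_if_long_paths_mem:
  fixes f :: "(('a, 'b) lpa_gen, 'r::{ring, monoid_mult}) free_alg"
  assumes f: "f \<in> span_words (nonunital_words (lpa_gens G))"
    and long: "\<And>u p r. awalk u p r \<Longrightarrow> long_or_maximal n p r \<Longrightarrow> lpa_eq G (f * mon (path_word u p)) 0"
  shows "lpa_eq G f 0"
proof -
  have all: "lpa_eq G (f * mon (path_word u p)) 0" if "awalk u p r" "long_or_maximal (n - j) p r" for j u p r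
    using that
  proof (induction j arbitrary: u p r)
    case 0
    then show ?case by (simp add: long)
  next
    case (Suc j)
    show ?case
    proof (cases "long_or_maximal (n - j) p r")
      case True
      then show ?thesis using Suc by blast
    next
      case False
      \<comment> \<open>Here the length of \<open>p\<close> is exactly \<open>n - Suc j\<close>, and one more edge suffices.\<close>
      then have r: "regular_vertex G r" and len: "n - j \<le> Suc (length p)"
        using Suc.prems by (auto simp: long_or_maximal_def regular_vertex_def)
      show ?thesis
      proof (rule mem_ideal_if_extensions_mem[OF Suc.prems(1) r f])
        fix e assume "e \<in> out_arcs G r"
        then have "awalk u (p @ [e]) (head G e)"
          using Suc.prems(1) by (auto simp: awalk_Cons_iff awalk_Nil_iff)
        moreover have "long_or_maximal (n - j) (p @ [e]) (head G e)"
          using len by (simp add: long_or_maximal_def)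
        ultimately show "lpa_eq G (f * mon (path_word u (p @ [e]))) 0"
          by (rule Suc.IH)
      qed
    qed
  qed
  have "lpa_eq G f (\<Sum>v\<in>verts G. f * mon [Vert v])"
    by (rule rel_eq_sym[OF vertices_local_unit[OF f]])
  also have "lpa_eq G \<dots> (\<Sum>v\<in>verts G. 0)"
  proof (rule rel_eq_sum)
    fix v assume "v \<in> verts G"
    then show "lpa_eq G (f * mon [Vert v]) 0"
      using all[of v "[]" v n] by (simp add: awalk_Nil_iff long_or_maximal_def path_word_def)
  qed
  finally show ?thesis by simp
qed

end

section \<open>The substitution given by prefix codes\<close>

text \<open>
  Completeness of the edge codes is left out of the locale because it is a statement about a
  particular coefficient ring.
\<close>

locale graph_code = fin_digraph E for E :: "('v, 'e) pre_digraph" +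
  fixes vcode :: "'v \<Rightarrow> bool list" and ecode :: "'e \<Rightarrow> bool list"
  assumes vcode_parallel:
      "v \<in> verts E \<Longrightarrow> w \<in> verts E \<Longrightarrow> v \<noteq> w \<Longrightarrow> vcode v \<parallel> vcode w"
    and ecode_parallel:
      "e \<in> arcs E \<Longrightarrow> f \<in> arcs E \<Longrightarrow> tail E e = tail E f \<Longrightarrow> e \<noteq> f \<Longrightarrow> ecode e \<parallel> ecode f"
begin

text \<open>A generator \<open>g\<close> is sent to the monomial \<open>[left_code g, right_code g]\<close>.\<close>

primrec left_code :: "('v, 'e) lpa_gen \<Rightarrow> bool list" where
  "left_code (Vert v) = vcode v"
| "left_code (Edge e) = vcode (tail E e) @ ecode e"
| "left_code (Ghost e) = vcode (head E e)"

primrec right_code :: "('v, 'e) lpa_gen \<Rightarrow> bool list" where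
  "right_code (Vert v) = vcode v"
| "right_code (Edge e) = vcode (head E e)"
| "right_code (Ghost e) = vcode (tail E e) @ ecode e"

definition subst_word :: "('v, 'e) lpa_gen word \<Rightarrow> leavitt_gen word" where
  "subst_word w =
    Word (concat (map (\<lambda>g. xword (left_code g) @ xstar (right_code g)) (letters w)))"

abbreviation subst :: "(('v, 'e) lpa_gen, 'r::{ring, monoid_mult}) free_alg \<Rightarrow>
    (leavitt_gen, 'r) free_alg" where
  "subst \<equiv> push subst_word"

lemma subst_word_add: "subst_word (v + w) = subst_word v + subst_word w"
  by (simp add: subst_word_def plus_word_def)

lemma subst_mult: "subst (f * h) = subst f * subst h"
  by (rule push_mult) (rule subst_word_add)

lemma subst_coef: "subst (coef c) = coef c"
  by (simp add: coef_def subst_word_def zero_word_def)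

lemma subst_gen: "subst (gen g) = xmon (left_code g) (right_code g)"
  by (simp add: gen_def subst_word_def)

lemma subst_relation:
  assumes complete: "\<And>v. regular_vertex E v \<Longrightarrow>
      (\<Sum>e\<in>out_arcs E v. xmon (ecode e) (ecode e) ::
        (leavitt_gen, 'r::{ring, monoid_mult}) free_alg) \<approx> mon []"
    and ab: "(a, b :: (('v, 'e) lpa_gen, 'r) free_alg) \<in> lpa_rels E"
  shows "subst a \<approx> subst b"
  using ab[unfolded lpa_rels_def]
proof (elim UnE CollectE exE conjE; clarify)
  fix v w assume "v \<in> verts E" "w \<in> verts E"
  then show "subst (gen (Vert v) * gen (Vert w)) \<approx>
      subst (if v = w then gen (Vert w) else 0 :: (('v, 'e) lpa_gen, 'r) free_alg)"
    by (auto simp: subst_mult subst_gen xmon_mult_same xmon_mult_parallel vcode_parallel)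
next
  fix e assume "e \<in> arcs E"
  show "subst (gen (Vert (tail E e)) * gen (Edge e)) \<approx>
      (subst (gen (Edge e)) :: (leavitt_gen, 'r) free_alg)"
    using xmon_mult_right_longer[of "vcode (tail E e)" "vcode (tail E e)" "ecode e"]
    by (simp add: subst_mult subst_gen)
  show "subst (gen (Edge e) * gen (Vert (head E e))) \<approx>
      (subst (gen (Edge e)) :: (leavitt_gen, 'r) free_alg)"
    using xmon_mult_same[of "vcode (tail E e) @ ecode e"]
    by (simp add: subst_mult subst_gen)
  show "subst (gen (Vert (head E e)) * gen (Ghost e)) \<approx>
      (subst (gen (Ghost e)) :: (leavitt_gen, 'r) free_alg)"
    using xmon_mult_same[of "vcode (head E e)" "vcode (head E e)" "vcode (tail E e) @ ecode e"]
    by (simp add: subst_mult subst_gen)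
  show "subst (gen (Ghost e) * gen (Vert (tail E e))) \<approx>
      (subst (gen (Ghost e)) :: (leavitt_gen, 'r) free_alg)"
    using xmon_mult_left_longer[of "vcode (head E e)" "vcode (tail E e)" "ecode e"]
    by (simp add: subst_mult subst_gen)
next
  fix e f assume ef: "e \<in> arcs E" "f \<in> arcs E"
  have "vcode (tail E e) @ ecode e \<parallel> vcode (tail E f) @ ecode f" if "e \<noteq> f"
  proof (cases "tail E e = tail E f")
    case True
    then show ?thesis
      using ecode_parallel[OF ef True that] by (simp add: parallel_def)
  next
    case False
    then show ?thesis
      using ef by (intro parallel_append vcode_parallel) auto
  qed
  then show "subst (gen (Ghost e) * gen (Edge f)) \<approx>
      subst (if e = f then gen (Vert (head E e)) else 0 :: (('v, 'e) lpa_gen, 'r) free_alg)"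
    using xmon_mult_same[of "vcode (head E e)" "vcode (tail E e) @ ecode e" "vcode (head E e)"]
      xmon_mult_parallel[of "vcode (tail E e) @ ecode e" "vcode (tail E f) @ ecode f"
        "vcode (head E e)" "vcode (head E f)"]
    by (auto simp: subst_mult subst_gen)
next
  fix v assume v: "regular_vertex E v"
  have "mon (xword (vcode v)) * (\<Sum>e\<in>out_arcs E v. xmon (ecode e) (ecode e)) *
      mon (xstar (vcode v)) \<approx>
      mon (xword (vcode v)) * mon [] * (mon (xstar (vcode v)) :: (leavitt_gen, 'r) free_alg)"
    by (rule leavitt_eq_context[OF complete[OF v]])
  then have "subst (gen (Vert v) :: (('v, 'e) lpa_gen, 'r) free_alg) \<approx>
      mon (xword (vcode v)) * (\<Sum>e\<in>out_arcs E v. xmon (ecode e) (ecode e)) *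
      mon (xstar (vcode v))"
    by (simp add: subst_gen mon_mult rel_eq_sym)
  also have "\<dots> = (\<Sum>e\<in>out_arcs E v. xmon (vcode v @ ecode e) (vcode v @ ecode e))"
    by (simp add: sum_distrib_left sum_distrib_right mon_mult)
  also have "\<dots> \<approx> (\<Sum>e\<in>out_arcs E v. xmon (vcode v @ ecode e) (vcode (head E e)) *
      xmon (vcode (head E e)) (vcode v @ ecode e))"
    by (intro rel_eq_sum rel_eq_sym[OF xmon_mult_same])
  also have "\<dots> = subst (\<Sum>e\<in>out_arcs E v. gen (Edge e) * gen (Ghost e))"
    unfolding push_sum by (intro sum.cong) (simp_all add: subst_mult subst_gen)
  finally show "subst (gen (Vert v)) \<approx>
      (subst (\<Sum>e\<in>out_arcs E v. gen (Edge e) * gen (Ghost e)) :: (leavitt_gen, 'r) free_alg)" .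
qed

lemma subst_rel_ideal:
  assumes complete: "\<And>v. regular_vertex E v \<Longrightarrow>
      (\<Sum>e\<in>out_arcs E v. xmon (ecode e) (ecode e) ::
        (leavitt_gen, 'r::{ring, monoid_mult}) free_alg) \<approx> mon []"
    and f: "(f :: (('v, 'e) lpa_gen, 'r) free_alg) \<in> rel_ideal W (lpa_rels E)"
  shows "subst f \<in> rel_ideal UNIV leavitt_rels"
  using f
proof induction
  case (base a b)
  then show ?case using subst_relation[OF complete] by (simp add: rel_eq_def)
qed (simp_all add: subst_mult subst_coef rel_ideal.zero rel_ideal.diff rel_ideal.coef_left
    rel_ideal.coef_right rel_ideal.mult_left rel_ideal.mult_right)

section \<open>Condition (L) separates real paths\<close>

text \<open>
  The edges with empty code form a subgraph, and a nonempty closed walk in it contains a cycle of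
  this subgraph.  An exit of that cycle would need a code incomparable to the empty string.
\<close>

lemma closed_walk_of_empty_codes:
  assumes L: "condition_L E" and p: "awalk u p u" and empty: "concat (map ecode p) = []"
  shows "p = []"
proof (rule ccontr)
  assume "p \<noteq> []"
  define H where "H = E\<lparr>arcs := {e \<in> arcs E. ecode e = []}\<rparr>"
  interpret H: wf_digraph H
    by standard (auto simp: H_def)
  have cas: "pre_digraph.cas H x q y = cas x q y" for x q y
    by (induction q arbitrary: x) (simp_all add: H_def pre_digraph.cas.simps)
  have verts: "pre_digraph.awalk_verts H x q = awalk_verts x q" for x q
    by (induction q arbitrary: x) (simp_all add: H_def pre_digraph.awalk_verts.simps)
  have awalk: "H.awalk x q y \<longleftrightarrow> awalk x q y \<and> concat (map ecode q) = []" for x q y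
    unfolding H.awalk_def awalk_def cas by (auto simp: H_def)
  have "H.awalk u p u"
    using p empty by (simp add: awalk)
  then have "H.closed_w p"
    using \<open>p \<noteq> []\<close> by (auto simp: H.closed_w_def)
  then obtain q where "H.cycle q"
    using H.closed_w_imp_cycle by blast
  then have q: "cycle q" "concat (map ecode q) = []"
    by (auto simp: H.cycle_def cycle_def awalk verts)
  then obtain f e where "f \<in> arcs E" "e \<in> set q" "tail E f = tail E e" "f \<noteq> e"
    using L by (auto simp: condition_L_def is_exit_def)
  moreover have "e \<in> arcs E"
    using q(1) \<open>e \<in> set q\<close> by (auto simp: cycle_def awalk_def)
  ultimately have "ecode f \<parallel> ecode e"
    by (intro ecode_parallel) auto
  then show False
    using q(2) \<open>e \<in> set q\<close> by (auto simp: parallel_def)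
qed

text \<open>
  Reading the code from the front determines one edge after the other.  It is only the end of
  the shorter walk that the code might not reveal; from there on the longer walk is closed,
  since both end in \<open>r\<close>, and consists of edges with empty code.
\<close>

lemma walks_with_same_code:
  assumes L: "condition_L E"
  shows "awalk u p r \<Longrightarrow> awalk u q r \<Longrightarrow> concat (map ecode p) = concat (map ecode q) \<Longrightarrow> p = q"
proof (induction p arbitrary: u q)
  case Nil
  then show ?case
    using closed_walk_of_empty_codes[OF L, of u q] by (simp add: awalk_Nil_iff)
next
  case (Cons e p)
  show ?case
  proof (cases q)
    case Nil
    then show ?thesis
      using closed_walk_of_empty_codes[OF L, of u "e # p"] Cons.prems by (simp add: awalk_Nil_iff)
  next
    case q: (Cons f q')
    have "e = f"
    proof (rule ccontr)
      assume "e \<noteq> f"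
      then have "ecode e \<parallel> ecode f"
        using Cons.prems(1,2) unfolding q
        by (intro ecode_parallel) (auto simp: awalk_Cons_iff)
      then have "concat (map ecode (e # p)) \<parallel> concat (map ecode (f # q'))"
        by (simp add: parallel_append)
      then show False
        using Cons.prems(3) unfolding q by (simp add: parallel_def)
    qed
    then show ?thesis
      using Cons q by (auto simp: awalk_Cons_iff)
  qed
qed

lemma word_act_add_word: "word_act (v + w) m = word_act v (word_act w m)"
  by (simp add: word_act_def plus_word_def)

lemma word_act_path:
  assumes "awalk u p r"
  shows "word_act (subst_word (Word (path_word u p))) (unit_at (numeral_of (vcode r))) =
    (unit_at (numeral_of (vcode u @ concat (map ecode p))) :: nat \<Rightarrow> 'r::{ring, monoid_mult})"
proof -
  let ?X = "\<lambda>g. Word (xword (left_code g) @ xstar (right_code g))"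
  have subst_Cons: "subst_word (Word (g # ls)) = ?X g + subst_word (Word ls)" for g ls
    by (simp add: subst_word_def plus_word_def)
  have "word_act (subst_word (Word (map Edge p))) (unit_at (numeral_of (vcode r))) =
    (unit_at (numeral_of (vcode u @ concat (map ecode p))) :: nat \<Rightarrow> 'r)"
    using assms
  proof (induction p arbitrary: u)
    case Nil
    then show ?case
      by (simp add: word_act_def subst_word_def awalk_Nil_iff)
  next
    case (Cons e p)
    then have "tail E e = u"
      and "word_act (subst_word (Word (map Edge p))) (unit_at (numeral_of (vcode r))) =
        (unit_at (numeral_of (vcode (head E e) @ concat (map ecode p))) :: nat \<Rightarrow> 'r)"
      by (auto simp: awalk_Cons_iff)
    then show ?case
      using word_act_xmon[of "vcode u @ ecode e" "vcode (head E e)" "concat (map ecode p)"]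
      by (simp add: subst_Cons word_act_add_word)
  qed
  then show ?thesis
    by (simp add: path_word_def subst_Cons word_act_add_word word_act_xmon)
qed

lemma act_subst:
  "act (subst f) m n =
    (\<Sum>w\<in>Poly_Mapping.keys f. Poly_Mapping.lookup f w * word_act (subst_word w) m n)"
proof -
  have "act (subst f) m n = lin_ext (\<lambda>w c. c * word_act (subst_word w) m n) f"
    by (induction f rule: free_alg_induct)
       (simp_all add: act_add act_single lin_ext_add lin_ext_single distrib_right)
  then show ?thesis by (simp add: lin_ext_def)
qed

text \<open>
  Apply the image of \<open>g\<close> to the indicator function of the number coded by \<open>w\<^sub>r\<close>.  Each path is sent
  to the indicator function of a number of its own, where the value is the coefficient of
  that path in \<open>g\<close>.
\<close>

lemma path_combination_eq_zero:
  assumes L: "condition_L E"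
    and g: "g \<in> span_words {Word (path_word u p) | u p. awalk u p r}"
    and ker: "subst g \<in> rel_ideal UNIV leavitt_rels"
  shows "g = (0 :: (('v, 'e) lpa_gen, 'r::{ring, monoid_mult}) free_alg)"
proof (rule ccontr)
  assume "g \<noteq> 0"
  then obtain w where w: "w \<in> Poly_Mapping.keys g"
    by (metis poly_mapping_eqI lookup_zero in_keys_iff)
  then obtain u p where up: "w = Word (path_word u p)" "awalk u p r"
    using g by (auto simp: span_words_def)
  let ?m = "unit_at (numeral_of (vcode r)) :: nat \<Rightarrow> 'r"
  let ?n = "numeral_of (vcode u @ concat (map ecode p))"
  have coeff: "word_act (subst_word x) ?m ?n = (if x = w then 1 else 0)"
    if "x \<in> Poly_Mapping.keys g" for x
  proof -
    from that g obtain v q where vq: "x = Word (path_word v q)" "awalk v q r"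
      by (auto simp: span_words_def)
    have "v = u \<and> q = p" if "?n = numeral_of (vcode v @ concat (map ecode q))"
    proof -
      have eq: "vcode u @ concat (map ecode p) = vcode v @ concat (map ecode q)"
        using that inj_numeral_of by (simp add: inj_eq)
      have "v = u"
        using vcode_parallel[of v u] up(2) vq(2) eq
        by (metis awalk_hd_in_verts parallelD1 parallel_append prefix_order.refl)
      with eq up(2) vq(2) show ?thesis
        using walks_with_same_code[OF L] by auto
    qed
    then have "?n = numeral_of (vcode v @ concat (map ecode q)) \<longleftrightarrow> x = w"
      by (auto simp: vq(1) up(1) path_word_def inj_map_eq_map inj_def)
    then show ?thesis
      unfolding vq(1) word_act_path[OF vq(2)] by simp
  qed
  have "0 = act (subst g) ?m ?n"
    using act_rel_ideal[OF ker] by simp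
  also have "\<dots> = (\<Sum>x\<in>Poly_Mapping.keys g. if x = w then Poly_Mapping.lookup g x else 0)"
    unfolding act_subst by (intro sum.cong) (simp_all add: coeff)
  also have "\<dots> = Poly_Mapping.lookup g w"
    using w by simp
  finally show False
    using w by (simp add: in_keys_iff)
qed

end

section \<open>The embedding\<close>

lemma (in graph_code) subst_injective:
  fixes f :: "(('v, 'e) lpa_gen, 'r::{ring, monoid_mult}) free_alg"
  assumes complete: "\<And>v. regular_vertex E v \<Longrightarrow>
      (\<Sum>e\<in>out_arcs E v. xmon (ecode e) (ecode e) :: (leavitt_gen, 'r) free_alg) \<approx> mon []"
    and L: "condition_L E"
    and f: "f \<in> span_words (nonunital_words (lpa_gens E))"
    and ker: "subst f \<in> rel_ideal UNIV leavitt_rels"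
  shows "f \<in> rel_ideal (nonunital_words (lpa_gens E)) (lpa_rels E)"
proof -
  \<comment> \<open>The element \<open>0\<close> is inserted because \<open>f\<close> may vanish.\<close>
  define n where "n = Max (insert 0 ((length \<circ> letters) ` Poly_Mapping.keys f))"
  have "Poly_Mapping.keys f \<subseteq> {Word ls | ls. set ls \<subseteq> lpa_gens E \<and> length ls \<le> n}"
  proof
    fix w assume w: "w \<in> Poly_Mapping.keys f"
    then have "length (letters w) \<le> n" by (simp add: n_def)
    moreover have "w \<in> nonunital_words (lpa_gens E)"
      using w f by (auto simp: span_words_def)
    ultimately show "w \<in> {Word ls | ls. set ls \<subseteq> lpa_gens E \<and> length ls \<le> n}"
      by (cases w) (auto simp: nonunital_words_def)
  qed
  then have fn: "f \<in> span_words {Word ls | ls. set ls \<subseteq> lpa_gens E \<and> length ls \<le> n}"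
    by (simp add: span_words_def)
  have "lpa_eq E f 0"
  proof (rule mem_ideal_if_long_paths_mem[OF f])
    fix u p r assume p: "awalk u p r" "long_or_maximal n p r"
    obtain g where g: "g \<in> span_words {Word (path_word v q) | v q. awalk v q r}"
      and eq: "lpa_eq E (f * mon (path_word u p)) g"
      using mult_path_reduces[OF fn p] by blast
    have "subst (f * mon (path_word u p)) \<approx> subst g"
      using subst_rel_ideal[OF complete] eq by (simp add: rel_eq_def flip: push_diff)
    moreover have "subst (f * mon (path_word u p)) \<in> rel_ideal UNIV leavitt_rels"
      using ker by (simp add: subst_mult rel_ideal.mult_right)
    ultimately have "subst g \<in> rel_ideal UNIV leavitt_rels"
      by (simp add: rel_eq_mem)
    with path_combination_eq_zero[OF L g] eq show "lpa_eq E (f * mon (path_word u p)) 0"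
      by simp
  qed
  then show ?thesis by (simp add: rel_eq_zero)
qed

text \<open>
  A homomorphism of free algebras that maps an ideal of relations into another one induces a
  homomorphism of the quotients, and this is injective if the preimage is no larger.
\<close>

lemma presented_algebra_embedding:
  fixes \<Phi> :: "('g, 'r::ring) free_alg \<Rightarrow> ('h, 'r) free_alg"
  assumes W: "\<And>u v. u \<in> W \<Longrightarrow> v \<in> W \<Longrightarrow> u + v \<in> W"
    and W': "\<And>u v. u \<in> W' \<Longrightarrow> v \<in> W' \<Longrightarrow> u + v \<in> W'"
    and span: "\<And>f. f \<in> span_words W \<Longrightarrow> \<Phi> f \<in> span_words W'"
    and add: "\<And>f h. \<Phi> (f + h) = \<Phi> f + \<Phi> h"
    and mult: "\<And>f h. \<Phi> (f * h) = \<Phi> f * \<Phi> h"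
    and coef: "\<And>c. \<Phi> (coef c) = coef c"
    and ker: "\<And>f. f \<in> span_words W \<Longrightarrow> \<Phi> f \<in> rel_ideal W' S' \<longleftrightarrow> f \<in> rel_ideal W S"
  shows "\<exists>\<phi> \<in> ralgebra_hom (presented_algebra W S) (presented_algebra W' S').
    inj_on \<phi> (acarrier (presented_algebra W S))"
proof -
  let ?cl = "\<lambda>f. rel_cong W S `` {f}" and ?cl' = "\<lambda>f. rel_cong W' S' `` {f}"
  define \<phi> where "\<phi> A = (\<Union>a\<in>A. ?cl' (\<Phi> a))" for A
  have diff: "\<Phi> (f - h) = \<Phi> f - \<Phi> h" for f h
    using add[of "f - h" h] by (simp add: algebra_simps)
  have span_diff: "f - h \<in> span_words W" if "f \<in> span_words W" "h \<in> span_words W" for f h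
    using that keys_diff[of f h] by (auto simp: span_words_def)
  have cong: "(\<Phi> f, \<Phi> h) \<in> rel_cong W' S' \<longleftrightarrow> (f, h) \<in> rel_cong W S"
    if "f \<in> span_words W" "h \<in> span_words W" for f h
    using that span ker[OF span_diff[OF that]] by (simp add: rel_cong_def diff)
  have "congruent (rel_cong W S) (\<lambda>a. ?cl' (\<Phi> a))"
  proof (rule congruentI)
    fix f h assume fh: "(f, h) \<in> rel_cong W S"
    then have "f \<in> span_words W" "h \<in> span_words W" by (simp_all add: rel_cong_def)
    with fh cong show "?cl' (\<Phi> f) = ?cl' (\<Phi> h)"
      by (intro equiv_class_eq[OF equiv_rel_cong]) simp
  qed
  then have \<phi>: "\<phi> (?cl f) = ?cl' (\<Phi> f)" if "f \<in> span_words W" for f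
    unfolding \<phi>_def using UN_equiv_class[OF equiv_rel_cong _ that] by blast
  have carrier: "acarrier (presented_algebra W S) = ?cl ` span_words W"
    by (auto simp: presented_algebra_def quotient_def)
  have carrier': "acarrier (presented_algebra W' S') = ?cl' ` span_words W'"
    by (auto simp: presented_algebra_def quotient_def)
  have "\<phi> \<in> ralgebra_hom (presented_algebra W S) (presented_algebra W' S')"
    unfolding ralgebra_hom_def mem_Collect_eq carrier carrier' ball_simps
    by (intro conjI ballI allI)
      (simp_all add: \<phi> span imageI presented_algebra_add presented_algebra_mult[OF W]
        presented_algebra_mult[OF W'] presented_algebra_lscale presented_algebra_rscale
        span_words_add span_words_mult[OF W] span_words_coef add mult coef)
  moreover have "inj_on \<phi> (acarrier (presented_algebra W S))"
    unfolding carrier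
  proof (rule inj_onI; clarify)
    fix f h assume fh: "f \<in> span_words W" "h \<in> span_words W" and "\<phi> (?cl f) = \<phi> (?cl h)"
    then have "(\<Phi> f, \<Phi> h) \<in> rel_cong W' S'"
      using span by (simp add: \<phi> eq_equiv_class_iff[OF equiv_rel_cong])
    then show "?cl f = ?cl h"
      using fh by (simp add: cong equiv_class_eq[OF equiv_rel_cong])
  qed
  ultimately show ?thesis by blast
qed

theorem theorem2p5:
  fixes scale :: "'k::field \<Rightarrow> 'r::{ring, monoid_mult} \<Rightarrow> 'r"
    and E :: "('v, 'e) pre_digraph"
  assumes "unital_algebra scale"
    and "fin_digraph E"
    and "condition_L E"
  shows "\<exists>\<phi> \<in> ralgebra_hom (leavitt_path_algebra TYPE('r) E) (leavitt_algebra_1_2 TYPE('r)).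
           inj_on \<phi> (acarrier (leavitt_path_algebra TYPE('r) E))"
proof -
  interpret fin_digraph E by fact
  define good :: "'e set \<Rightarrow> ('e \<Rightarrow> bool list) \<Rightarrow> bool" where "good A u \<longleftrightarrow>
      (\<forall>e\<in>A. \<forall>f\<in>A. e \<noteq> f \<longrightarrow> u e \<parallel> u f) \<and>
      (A \<noteq> {} \<longrightarrow> (\<Sum>e\<in>A. xmon (u e) (u e) :: (leavitt_gen, 'r) free_alg) \<approx> mon [])" for A u
  have "\<forall>v. \<exists>u. good (out_arcs E v) u"
  proof
    fix v
    show "\<exists>u. good (out_arcs E v) u"
    proof (cases "out_arcs E v = {}")
      case True
      then show ?thesis by (simp add: good_def)
    next
      case False
      show ?thesis
        using complete_prefix_code_exists[OF finite_out_arcs False, where 'r = 'r]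
        unfolding good_def by (elim ex_forward) simp
    qed
  qed
  from choice[OF this] obtain u where u: "\<forall>v. good (out_arcs E v) (u v)"
    by (elim exE)
  have "\<exists>vcode :: 'v \<Rightarrow> bool list.
      \<forall>v\<in>verts E. \<forall>w\<in>verts E. v \<noteq> w \<longrightarrow> vcode v \<parallel> vcode w"
  proof (cases "verts E = {}")
    case False
    show ?thesis
      using complete_prefix_code_exists[OF finite_verts False, where 'r = 'r]
      by (elim ex_forward) simp
  qed simp
  then obtain vcode :: "'v \<Rightarrow> bool list"
    where vcode: "\<forall>v\<in>verts E. \<forall>w\<in>verts E. v \<noteq> w \<longrightarrow> vcode v \<parallel> vcode w"
    by (elim exE)
  define ecode where "ecode e = u (tail E e) e" for e
  interpret graph_code E vcode ecode
  proof unfold_locales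
    show "vcode v \<parallel> vcode w" if "v \<in> verts E" "w \<in> verts E" "v \<noteq> w" for v w
      using vcode that by blast
    show "ecode e \<parallel> ecode f"
      if "e \<in> arcs E" "f \<in> arcs E" "tail E e = tail E f" "e \<noteq> f" for e f
      using u that by (simp add: good_def ecode_def)
  qed
  have complete: "(\<Sum>e\<in>out_arcs E v. xmon (ecode e) (ecode e) :: (leavitt_gen, 'r) free_alg) \<approx> mon []"
    if "regular_vertex E v" for v
  proof -
    have "(\<Sum>e\<in>out_arcs E v. xmon (ecode e) (ecode e) :: (leavitt_gen, 'r) free_alg) =
        (\<Sum>e\<in>out_arcs E v. xmon (u v e) (u v e))"
      by (intro sum.cong) (auto simp: ecode_def)
    then show ?thesis using u that by (simp add: good_def regular_vertex_def)
  qed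
  show ?thesis
    unfolding leavitt_path_algebra_def leavitt_algebra_1_2_def
  proof (rule presented_algebra_embedding[where \<Phi> = subst])
    show "subst f \<in> rel_ideal (unital_words UNIV) leavitt_rels \<longleftrightarrow>
        f \<in> rel_ideal (nonunital_words (lpa_gens E)) (lpa_rels E)"
      if "f \<in> span_words (nonunital_words (lpa_gens E))"
      for f :: "(('v, 'e) lpa_gen, 'r) free_alg"
      using subst_rel_ideal[OF complete] subst_injective[OF complete assms(3) that]
      unfolding unital_words_UNIV by blast
  qed (simp_all add: words_closed subst_mult subst_coef)
qed

end
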